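(* Let $G$ be a finite metacyclic group, i.e. a finite group with a normal subgroup $K$ such that $K$ and $G/K$ are both cyclic. Then $G$ is not an Ingleton violator; that is, there is no quadruple of subgroups of $G$ that is an Ingleton offender.
   Context: For subgroups $H_1,H_2,H_3,H_4$ of a finite group $G$, write $H_{12}=H_1\cap H_2$, $H_{123}=H_1\cap H_2\cap H_3$, and so on. The quadruple $(H_1,H_2,H_3,H_4)$ is an Ingleton offender if the inequality $|H_1|\cdot|H_2|\cdot|H_{34}|\cdot|H_{123}|\cdot|H_{124}|\geq |H_{12}|\cdot|H_{13}|\cdot|H_{14}|\cdot|H_{23}|\cdot|H_{24}|$ is not satisfied. A finite group $G$ is an Ingleton violator if it contains an Ingleton offender, i.e. if some quadruple of subgroups of $G$ is an Ingleton offender. *)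

theory Defs
  imports "HOL-Algebra.Elementary_Groups"
begin

definition metacyclic_group :: "('a, 'b) monoid_scheme \<Rightarrow> bool"
  where "metacyclic_group G \<longleftrightarrow>
    (\<exists>K. K \<lhd> G \<and> cyclic_group (G\<lparr>carrier := K\<rparr>) \<and> cyclic_group (G Mod K))"

definition ingleton_offender ::
    "('a, 'b) monoid_scheme \<Rightarrow> 'a set \<Rightarrow> 'a set \<Rightarrow> 'a set \<Rightarrow> 'a set \<Rightarrow> bool"
  where "ingleton_offender G H1 H2 H3 H4 \<longleftrightarrow>
    subgroup H1 G \<and> subgroup H2 G \<and> subgroup H3 G \<and> subgroup H4 G \<and>
    \<not> (card H1 * card H2 * card (H3 \<inter> H4) * card (H1 \<inter> H2 \<inter> H3) * card (H1 \<inter> H2 \<inter> H4)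
        \<ge> card (H1 \<inter> H2) * card (H1 \<inter> H3) * card (H1 \<inter> H4) * card (H2 \<inter> H3) * card (H2 \<inter> H4))"

definition ingleton_violator :: "('a, 'b) monoid_scheme \<Rightarrow> bool"
  where "ingleton_violator G \<longleftrightarrow> (\<exists>H1 H2 H3 H4. ingleton_offender G H1 H2 H3 H4)"

end

theory Submission
  imports
    Defs
    "HOL-Algebra.Multiplicative_Group"
    "HOL-Algebra.Zassenhaus"
    "HOL-Computational_Algebra.Primes"
begin

text \<open>Let \<open>K\<close> be cyclic and normal with cyclic quotient, and let \<open>A\<^sub>i\<close> be the intersection of \<open>H\<^sub>i\<close> with \<open>K\<close>.
  The order of a subgroup is the order of its intersection with \<open>K\<close> times the order of its image
  in the quotient. In a finite cyclic group the order of an intersection is the gcd of the orders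
  and the order of a product is their lcm, so the subgroup lattice is that of the divisors of an
  integer: it is distributive, and inequalities between orders can be checked one prime at a time.
  For the intersections with \<open>K\<close> this gives the Ingleton inequality at once. It need not hold for
  the images, because the image of an intersection can be smaller than the intersection of the
  images: two subgroups may meet a common coset of \<open>K\<close> in disjoint cosets of \<open>A\<^sub>i\<close> and \<open>A\<^sub>j\<close>. The proof
  shows that every such loss is paid for by the slack of the inequality in \<open>K\<close>.

  Three facts control the losses. First, cosets of \<open>A\<^sub>1\<close>, \<open>A\<^sub>2\<close>, \<open>A\<^sub>3\<close> that meet pairwise
  have a common point, by distributivity (\<open>proj_Helly\<close>), so the images of the triple intersections
  are determined by the images of the pairwise ones. Second, if \<open>H\<^sub>3\<close> and \<open>H\<^sub>4\<close> are joined inside a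
  coset of \<open>K\<close> by a chain of meeting subgroups through \<open>H\<^sub>1\<close> and \<open>H\<^sub>2\<close>, then they meet there after
  \<open>H\<^sub>3\<close> is enlarged by \<open>N = A\<^sub>1 A\<^sub>2\<close> (\<open>proj_subset_proj_set_mult_Int\<close>). Third, if \<open>H\<^sub>1\<close> and \<open>H\<^sub>2\<close> both
  meet \<open>H\<^sub>3\<close> and \<open>H\<^sub>4\<close> in a coset of \<open>K\<close>, then they meet there after \<open>H\<^sub>1\<close> is enlarged by the
  intersection \<open>M\<close> of \<open>A\<^sub>3\<close> and \<open>A\<^sub>4\<close> (\<open>proj_Int_subset_proj_set_mult_Int\<close>).

  Let \<open>E\<close> and \<open>E'\<close> be the intersections of \<open>N H\<^sub>3\<close> with \<open>H\<^sub>4\<close> and of \<open>M H\<^sub>1\<close> with \<open>H\<^sub>2\<close>, and write \<open>c\<close> for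
  the order of an image and \<open>a\<^sub>i\<close> for the order of \<open>A\<^sub>i\<close>. The facts above give the
  Ingleton inequality in the quotient with \<open>c\<^sub>3\<^sub>4\<close> replaced by \<open>c(E) c(E') / c\<^sub>1\<^sub>2\<close>
  (\<open>quotient_inequality\<close>). Enlarging one of two subgroups by a subgroup of
  \<open>K\<close> increases the image of their intersection by a bounded factor only
  (\<open>card_proj_set_mult_Int_le\<close>):
  \<open>c(E) \<le> c\<^sub>3\<^sub>4 lcm(a\<^sub>1, a\<^sub>2, a\<^sub>3, a\<^sub>4) / lcm(a\<^sub>3, a\<^sub>4)\<close> and
  \<open>c(E') \<le> c\<^sub>1\<^sub>2 lcm(a\<^sub>1, a\<^sub>2, gcd(a\<^sub>3, a\<^sub>4)) / lcm(a\<^sub>1, a\<^sub>2)\<close>.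
  The product of the two fractions is exactly the ratio of the two sides of the Ingleton
  inequality in \<open>K\<close> (\<open>kernel_identity\<close>), so that the product of the two parts is the claim.\<close>

section \<open>Divisor inequalities\<close>

text \<open>Here \<open>c\<close> with indices stands for the order of the image of an intersection, and \<open>e\<close>, \<open>e'\<close> for the
  orders of the images of the two enlarged intersections. For each prime the hypotheses say that
  certain exponents are at least minima of others, and the claim becomes piecewise linear in the
  exponents.
  The two hypotheses on \<open>e\<close> that involve \<open>c12\<close> are essential: with \<open>p\<close> prime,
  \<open>c1 = c2 = c12 = c14 = c23 = e' = p\<close> and the other variables equal to 1, the first of them is the
  only hypothesis to fail, and the claim reads \<open>p\<^sup>4 \<le> p\<^sup>3\<close>.\<close>

lemma quotient_inequality:
  fixes c1 c2 c12 c13 c14 c23 c24 c123 c124 e e' :: nat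
  assumes pos: "0 < c1" "0 < c2" "0 < c12" "0 < c13" "0 < c14" "0 < c23" "0 < c24"
      "0 < c123" "0 < c124" "0 < e" "0 < e'"
    and c1: "c12 dvd c1" "c13 dvd c1" "c14 dvd c1"
    and c2: "c12 dvd c2" "c23 dvd c2" "c24 dvd c2"
    and c123: "gcd c12 (gcd c13 c23) dvd c123" and c124: "gcd c12 (gcd c14 c24) dvd c124"
    and e: "gcd c13 c14 dvd e" "gcd c23 c24 dvd e"
      "gcd c23 (gcd c12 c14) dvd e" "gcd c13 (gcd c12 c24) dvd e"
    and e': "c12 dvd e'" "gcd (gcd c13 c14) (gcd c23 c24) dvd e'"
  shows "c12 * c12 * c13 * c14 * c23 * c24 \<le> c1 * c2 * e * e' * c123 * c124"
proof (rule dvd_imp_le[OF multiplicity_le_imp_dvd])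
  fix p :: nat assume p: "prime p"
  note nz = pos[THEN less_imp_neq, THEN not_sym]
  let ?v = "multiplicity p"
  have le: "?v x \<le> ?v y" if "x dvd y" "0 < y" for x y
    using that by (intro dvd_imp_multiplicity_le) auto
  have "?v c12 + ?v c12 + ?v c13 + ?v c14 + ?v c23 + ?v c24
      \<le> ?v c1 + ?v c2 + ?v e + ?v e' + ?v c123 + ?v c124"
    using c1[THEN le, OF pos(1)] c2[THEN le, OF pos(2)] c123[THEN le, OF pos(8)]
      c124[THEN le, OF pos(9)] e[THEN le, OF pos(10)] e'[THEN le, OF pos(11)] nz p
    by (simp add: multiplicity_gcd) linarith
  then show "?v (c12 * c12 * c13 * c14 * c23 * c24) \<le> ?v (c1 * c2 * e * e' * c123 * c124)"
    using p nz by (simp add: prime_elem_multiplicity_mult_distrib)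
qed (use pos in simp_all)

text \<open>For each prime, with exponents \<open>x\<^sub>1, \<dots>, x\<^sub>4\<close>, the slack of the Ingleton inequality in a cyclic group
  is \<open>max(0, min(x\<^sub>3, x\<^sub>4) - max(x\<^sub>1, x\<^sub>2)) + max(0, max(x\<^sub>1, x\<^sub>2) - max(x\<^sub>3, x\<^sub>4))\<close>. The two summands are
  the exponents of the lcm quotients on which the losses in the quotient group are charged.\<close>

lemma kernel_identity:
  fixes a1 a2 a3 a4 :: nat
  assumes "0 < a1" "0 < a2" "0 < a3" "0 < a4"
  shows "a1 * a2 * gcd a3 a4 * gcd a1 (gcd a2 a3) * gcd a1 (gcd a2 a4) * lcm a1 a2 * lcm a3 a4
    = gcd a1 a2 * gcd a1 a3 * gcd a1 a4 * gcd a2 a3 * gcd a2 a4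
        * lcm (lcm a1 a2) (gcd a3 a4) * lcm (lcm a3 a4) (lcm a1 a2)" (is "?l = ?r")
proof -
  have "normalize ?l = normalize ?r"
  proof (rule multiplicity_eq_imp_eq)
    fix p :: nat assume p: "prime p"
    then show "multiplicity p ?l = multiplicity p ?r"
      using assms
      apply (simp add: prime_elem_multiplicity_mult_distrib multiplicity_gcd multiplicity_lcm lcm_eq_0_iff)
      by linarith
  qed (use assms in \<open>simp_all add: lcm_eq_0_iff\<close>)
  then show ?thesis by simp
qed

section \<open>Subgroups of finite cyclic groups\<close>

context group
begin

lemma mult_inv_mult_inv:
  assumes "x \<in> carrier G" "y \<in> carrier G" "z \<in> carrier G"
  shows "(x \<otimes> inv y) \<otimes> (y \<otimes> inv z) = x \<otimes> inv z"
proof -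
  have "inv y \<otimes> (y \<otimes> inv z) = inv z" using assms by (simp flip: m_assoc)
  then show ?thesis using assms by (simp add: m_assoc)
qed

text \<open>All pairs in \<open>A \<times> B\<close> with the same product differ by an element of \<open>A \<inter> B\<close>; the choice of one
  pair for each product turns this into an injection.\<close>

lemma card_mult_le_card_set_mult:
  assumes "finite (carrier G)" "subgroup A G" "subgroup B G"
  shows "card A * card B \<le> card (A <#> B) * card (A \<inter> B)"
proof -
  interpret A: subgroup A G by fact
  interpret B: subgroup B G by fact
  define r where "r z = (SOME a. a \<in> A \<and> inv a \<otimes> z \<in> B)" for z
  have r: "r (a \<otimes> b) \<in> A \<and> inv (r (a \<otimes> b)) \<otimes> (a \<otimes> b) \<in> B" if "a \<in> A" "b \<in> B" for a b
    unfolding r_def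
    by (rule someI[of _ a])
      (use that in \<open>simp add: m_assoc[symmetric] A.mem_carrier B.mem_carrier\<close>)
  let ?f = "\<lambda>(a, b). (a \<otimes> b, inv (r (a \<otimes> b)) \<otimes> a)"
  have "inj_on ?f (A \<times> B)"
  proof (rule inj_onI, clarsimp)
    fix a b a' b'
    assume *: "a \<in> A" "b \<in> B" "a' \<in> A" "b' \<in> B" and eq: "a \<otimes> b = a' \<otimes> b'"
      and "inv (r (a' \<otimes> b')) \<otimes> a = inv (r (a' \<otimes> b')) \<otimes> a'"
    then have "a = a'"
      using r[of a' b'] by (simp add: A.mem_carrier)
    with eq * show "a = a' \<and> b = b'"
      by (simp add: A.mem_carrier B.mem_carrier)
  qed
  moreover have "?f ` (A \<times> B) \<subseteq> (A <#> B) \<times> (A \<inter> B)"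
  proof (clarsimp, intro conjI)
    fix a b assume ab: "a \<in> A" "b \<in> B"
    note r = r[OF ab]
    show "a \<otimes> b \<in> A <#> B" using ab by (auto simp: set_mult_def)
    show "inv (r (a \<otimes> b)) \<otimes> a \<in> A" using r ab by simp
    have "inv (r (a \<otimes> b)) \<otimes> a = (inv (r (a \<otimes> b)) \<otimes> (a \<otimes> b)) \<otimes> inv b"
      using r ab by (simp add: A.mem_carrier B.mem_carrier m_assoc)
    then show "inv (r (a \<otimes> b)) \<otimes> a \<in> B"
      using r ab by (metis B.m_closed B.m_inv_closed)
  qed
  moreover have "finite ((A <#> B) \<times> (A \<inter> B))"
    using assms(1) A.subset B.subset set_mult_closed[of A B]
    by (meson finite_Int finite_SigmaI finite_subset)
  ultimately have "card (A \<times> B) \<le> card ((A <#> B) \<times> (A \<inter> B))"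
    using card_inj_on_le by blast
  then show ?thesis by (simp add: card_cartesian_product)
qed

lemma card_subgroup_dvd:
  assumes "subgroup A G" "subgroup B G" "A \<subseteq> B"
  shows "card A dvd card B"
proof -
  have "card (rcosets\<^bsub>G\<lparr>carrier := B\<rparr>\<^esub> A) * card A = card B"
    using group.lagrange[OF subgroup_imp_group[OF assms(2)] subgroup_incl[OF assms]]
    by (simp add: order_def)
  then show ?thesis by (metis dvd_triv_right)
qed

lemma subgroup_pow_card:
  assumes "subgroup A G" "x \<in> A"
  shows "x [^] card A = \<one>"
proof -
  have "x [^]\<^bsub>G\<lparr>carrier := A\<rparr>\<^esub> card A = \<one>"
    using group.pow_order_eq_1[OF subgroup_imp_group[OF assms(1)], of x] assms(2)
    unfolding order_def by simp
  then show ?thesis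
    by (subst nat_pow_consistent[where H = A])
qed

lemma subgroup_pow_eq_one:
  assumes "subgroup A G" "x \<in> A" "card A dvd n"
  shows "x [^] n = \<one>"
proof -
  obtain k where n: "n = card A * k" using assms(3) by blast
  have "x [^] n = (x [^] card A) [^] k"
    using subgroup.mem_carrier[OF assms(1,2)] by (simp only: n nat_pow_pow)
  then show ?thesis using subgroup_pow_card[OF assms(1,2)] by simp
qed

text \<open>In a cyclic group of order \<open>n\<close> generated by \<open>g\<close>, the power \<open>g\<^sup>i\<close> is killed by \<open>d\<close> iff
  \<open>n / gcd(n, d)\<close> divides \<open>i\<close>, which leaves \<open>gcd(n, d)\<close> elements.\<close>

lemma cyclic_card_torsion_le:
  assumes fin: "finite (carrier G)" and cyc: "cyclic_group G" and d: "0 < d"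
  shows "card {x \<in> carrier G. x [^] (d::nat) = \<one>} \<le> d"
proof -
  obtain g where g: "g \<in> carrier G" and gen: "carrier G = range (\<lambda>i::int. g [^] i)"
    using cyc cyclic_group by blast
  define n where "n = ord g"
  have n: "0 < n" unfolding n_def using ord_ge_1[OF fin g] by simp
  define q where "q = gcd n d"
  have q: "0 < q" "q \<le> d" using d by (simp_all add: q_def gcd_le2_nat)
  obtain e d' where e: "n = e * q" and d': "d = d' * q" and "coprime e d'"
    using gcd_coprime_exists[of n d] n unfolding q_def by auto
  have "{x \<in> carrier G. x [^] d = \<one>} \<subseteq> (\<lambda>j. g [^] (int e * int j)) ` {..<q}"
  proof clarify
    fix x assume x: "x \<in> carrier G" "x [^] d = \<one>"
    then obtain i where i: "x = g [^] (i::int)" using gen by blast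
    have "g [^] (i * int d) = x [^] d"
      using g by (simp add: i int_pow_pow flip: int_pow_int)
    then have "int n dvd i * int d"
      using int_pow_eq_id[OF g] n_def x(2) by simp
    then have "int e dvd i * int d'" using q(1) by (simp add: e d' flip: mult.assoc)
    then have "int e dvd i" using \<open>coprime e d'\<close>
      by (simp add: coprime_dvd_mult_left_iff)
    then obtain j where j: "i = int e * j" by blast
    define j' where "j' = nat (j mod int q)"
    have j': "int j' = j mod int q" "j' < q" using q(1) by (simp_all add: j'_def nat_less_iff)
    have "i = int e * int j' + int n * (j div int q)"
      using mult_div_mod_eq[of "int q" j] by (simp add: j j' e algebra_simps flip: distrib_left)
    moreover have "g [^] (int n * (j div int q)) = \<one>"
      using int_pow_eq_id[OF g] n_def by simp
    ultimately have "x = g [^] (int e * int j')"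
      using g i by (simp add: int_pow_mult)
    with j'(2) show "x \<in> (\<lambda>j. g [^] (int e * int j)) ` {..<q}" by blast
  qed
  then have "card {x \<in> carrier G. x [^] d = \<one>} \<le> card {..<q}"
    by (rule surj_card_le[rotated]) simp
  then show ?thesis using q(2) by simp
qed

lemma cyclic_subgroup_eq_torsion:
  assumes "finite (carrier G)" "cyclic_group G" "subgroup A G"
  shows "A = {x \<in> carrier G. x [^] card A = \<one>}"
proof (rule card_seteq)
  show "A \<subseteq> {x \<in> carrier G. x [^] card A = \<one>}"
    using subgroup_pow_card[OF assms(3)] subgroup.subset[OF assms(3)] by auto
  have "0 < card A" using assms by (simp add: subgroup.finite_imp_card_positive)
  then show "card {x \<in> carrier G. x [^] card A = \<one>} \<le> card A"
    using cyclic_card_torsion_le assms by blast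
qed (use assms in simp)

text \<open>Lagrange bounds \<open>A \<inter> B\<close> by the gcd, and the torsion bound gives the lcm as a bound for the
  product, all of whose elements are killed by the lcm. Since gcd times lcm is \<open>|A| |B|\<close>, the product
  formula forces equality in both.\<close>

lemma cyclic_card_Int_set_mult:
  assumes fin: "finite (carrier G)" and cyc: "cyclic_group G" and A: "subgroup A G" and B: "subgroup B G"
  shows cyclic_card_Int: "card (A \<inter> B) = gcd (card A) (card B)"
    and cyclic_card_set_mult: "card (A <#> B) = lcm (card A) (card B)"
proof -
  interpret comm_group G using cyclic_imp_abelian_group[OF cyc] .
  have pos: "0 < card A" "0 < card B"
    using A B fin by (simp_all add: subgroup.finite_imp_card_positive)
  have AB: "subgroup (A \<inter> B) G" using A B by (rule subgroups_Inter_pair)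
  have le1: "card (A \<inter> B) \<le> gcd (card A) (card B)"
    using card_subgroup_dvd[OF AB A] card_subgroup_dvd[OF AB B] pos
    by (intro dvd_imp_le gcd_greatest) auto
  have "A <#> B \<subseteq> {x \<in> carrier G. x [^] lcm (card A) (card B) = \<one>}"
  proof
    fix x assume "x \<in> A <#> B"
    then obtain a b where x: "x = a \<otimes> b" "a \<in> A" "b \<in> B" unfolding set_mult_def by blast
    have c: "a \<in> carrier G" "b \<in> carrier G" using subgroup.mem_carrier[OF A x(2)] subgroup.mem_carrier[OF B x(3)] by simp_all
    have "a [^] lcm (card A) (card B) = \<one>" "b [^] lcm (card A) (card B) = \<one>"
      using subgroup_pow_eq_one[OF A x(2)] subgroup_pow_eq_one[OF B x(3)] by simp_all
    then show "x \<in> {x \<in> carrier G. x [^] lcm (card A) (card B) = \<one>}"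
      using c by (simp add: x pow_mult_distrib m_comm)
  qed
  then have "card (A <#> B) \<le> card {x \<in> carrier G. x [^] lcm (card A) (card B) = \<one>}"
    using fin by (intro card_mono) auto
  also have "\<dots> \<le> lcm (card A) (card B)"
    using cyclic_card_torsion_le[OF fin cyc] pos by (simp add: lcm_pos_nat)
  finally have le2: "card (A <#> B) \<le> lcm (card A) (card B)" .
  have prod: "lcm (card A) (card B) * gcd (card A) (card B) \<le> card (A <#> B) * card (A \<inter> B)"
    using card_mult_le_card_set_mult[OF fin A B] by simp
  have lg: "0 < lcm (card A) (card B)" "0 < gcd (card A) (card B)" using pos by (simp_all add: lcm_pos_nat)
  have "lcm (card A) (card B) * gcd (card A) (card B) \<le> lcm (card A) (card B) * card (A \<inter> B)"
    using prod mult_le_mono1[OF le2] by (rule le_trans)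
  then have ge1: "gcd (card A) (card B) \<le> card (A \<inter> B)"
    using lg mult_le_cancel1 by blast
  show "card (A \<inter> B) = gcd (card A) (card B)"
    using le1 ge1 by (rule le_antisym)
  then show "card (A <#> B) = lcm (card A) (card B)"
    using le2 prod lg by (metis le_antisym mult_le_cancel2)
qed

text \<open>One inclusion holds in every group, and the orders agree because gcd distributes over lcm.\<close>

lemma cyclic_Int_set_mult_distrib:
  assumes fin: "finite (carrier G)" and cyc: "cyclic_group G"
    and A: "subgroup A G" and B: "subgroup B G" and C: "subgroup C G"
  shows "A \<inter> (B <#> C) = (A \<inter> B) <#> (A \<inter> C)"
proof (rule sym, rule card_seteq)
  interpret comm_group G using cyclic_imp_abelian_group[OF cyc] .
  have BC: "subgroup (B <#> C) G" using B C by (simp add: mult_subgroups)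
  show "finite (A \<inter> (B <#> C))" using fin A by (meson finite_Int finite_subset subgroup.subset)
  show "(A \<inter> B) <#> (A \<inter> C) \<subseteq> A \<inter> (B <#> C)"
    using A by (auto simp: set_mult_def subgroup.m_closed)
  show "card (A \<inter> (B <#> C)) \<le> card ((A \<inter> B) <#> (A \<inter> C))"
    using assms BC by (simp add: cyclic_card_Int cyclic_card_set_mult subgroups_Inter_pair
        gcd_lcm_distrib)
qed
end

section \<open>Cyclic normal subgroups with cyclic quotient\<close>

locale finite_metacyclic = normal K G for K and G (structure) +
  assumes finite_carrier: "finite (carrier G)"
    and cyclic_kernel: "cyclic_group (G\<lparr>carrier := K\<rparr>)"
    and cyclic_quotient: "cyclic_group (G Mod K)"
begin

sublocale kernel: group "G\<lparr>carrier := K\<rparr>"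
  using subgroup_imp_group subgroup_axioms by blast

sublocale quotient: group "G Mod K"
  by (rule factorgroup_is_group)

lemma finite_kernel: "finite (carrier (G\<lparr>carrier := K\<rparr>))"
  using finite_carrier subset finite_subset by auto

lemma finite_quotient: "finite (carrier (G Mod K))"
  using finite_carrier by (simp add: FactGroup_def RCOSETS_def)

lemma kernel_commute: "x \<in> K \<Longrightarrow> y \<in> K \<Longrightarrow> x \<otimes> y = y \<otimes> x"
  using comm_monoid.m_comm[OF comm_group.axioms(1)[OF kernel.cyclic_imp_abelian_group[OF cyclic_kernel]], of x y]
  by simp

lemma kernel_subgroup: "subgroup A G \<Longrightarrow> A \<subseteq> K \<Longrightarrow> subgroup A (G\<lparr>carrier := K\<rparr>)"
  using subgroup_incl subgroup_axioms by blast

context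
  fixes A B
  assumes A: "subgroup A G" "A \<subseteq> K" and B: "subgroup B G" "B \<subseteq> K"
begin

lemma card_Int_kernel: "card (A \<inter> B) = gcd (card A) (card B)"
  using kernel.cyclic_card_Int[OF finite_kernel cyclic_kernel kernel_subgroup[OF A] kernel_subgroup[OF B]] .

lemma card_set_mult_kernel: "card (A <#> B) = lcm (card A) (card B)"
  using kernel.cyclic_card_set_mult[OF finite_kernel cyclic_kernel kernel_subgroup[OF A] kernel_subgroup[OF B]]
  by simp

lemma set_mult_kernel_subset: "A <#> B \<subseteq> K"
  using A(2) B(2) by (auto simp: set_mult_def)

lemma set_mult_kernel_commute: "A <#> B = B <#> A"
  using A(2) B(2) kernel_commute unfolding set_mult_def by blast

lemma subgroup_set_mult_kernel: "subgroup (A <#> B) G"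
proof -
  interpret comm_group "G\<lparr>carrier := K\<rparr>"
    by (rule kernel.cyclic_imp_abelian_group[OF cyclic_kernel])
  show ?thesis
    using mult_subgroups[OF kernel_subgroup[OF A] kernel_subgroup[OF B]]
    by (intro incl_subgroup[OF subgroup_axioms]) simp
qed

end

lemma Int_set_mult_kernel:
  assumes "subgroup A G" "A \<subseteq> K" "subgroup B G" "B \<subseteq> K" "subgroup C G" "C \<subseteq> K"
  shows "A \<inter> (B <#> C) = (A \<inter> B) <#> (A \<inter> C)"
  using kernel.cyclic_Int_set_mult_distrib[OF finite_kernel cyclic_kernel, of A B C] assms
  by (simp add: kernel_subgroup)

text \<open>A subgroup of \<open>K\<close> consists of all elements of \<open>K\<close> killed by its order, and conjugation preserves
  this condition.\<close>

lemma normal_kernel_subgroup: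
  assumes A: "subgroup A G" "A \<subseteq> K"
  shows "A \<lhd> G"
  unfolding normal_inv_iff
proof (intro conjI ballI A(1))
  fix x h assume x: "x \<in> carrier G" and h: "h \<in> A"
  then have hc: "h \<in> carrier G" using subgroup.mem_carrier[OF A(1)] by simp
  have "inv x \<otimes> (x \<otimes> y) = y" if "y \<in> carrier G" for y
    using that x by (simp flip: m_assoc)
  then have "(x \<otimes> h \<otimes> inv x) [^] n = x \<otimes> h [^] n \<otimes> inv x" for n :: nat
    using x hc by (induction n) (simp_all add: m_assoc)
  then have "(x \<otimes> h \<otimes> inv x) [^] card A = \<one>"
    using x subgroup_pow_card[OF A(1) h] by simp
  moreover have "x \<otimes> h \<otimes> inv x \<in> K"
    using inv_op_closed2[OF x] h A(2) by blast
  ultimately show "x \<otimes> h \<otimes> inv x \<in> A"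
    by (subst kernel.cyclic_subgroup_eq_torsion[OF finite_kernel cyclic_kernel kernel_subgroup[OF A]])
      (simp add: nat_pow_consistent[of _ "card A" K])
qed

definition proj :: "'a set \<Rightarrow> 'a set set"
  where "proj H = (\<lambda>x. K #> x) ` H"

lemma proj_mono: "H \<subseteq> H' \<Longrightarrow> proj H \<subseteq> proj H'"
  unfolding proj_def by blast

lemma subgroup_proj:
  assumes "subgroup H G"
  shows "subgroup (proj H) (G Mod K)"
proof -
  interpret group_hom G "G Mod K" "\<lambda>x. K #> x"
    by (intro group_hom.intro group_hom_axioms.intro r_coset_hom_Mod) unfold_locales
  show ?thesis unfolding proj_def by (rule subgroup_img_is_subgroup[OF assms])
qed

text \<open>A subgroup \<open>H\<close> meets a coset of \<open>K\<close> in a single coset of \<open>H \<inter> K\<close>. The comparison of the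
  subgroups inside a coset of \<open>K\<close> rests on this.\<close>

lemma coset_eqD:
  assumes "subgroup H G" "x \<in> H" "y \<in> H" "K #> x = K #> y"
  shows "x \<otimes> inv y \<in> H \<inter> K"
proof
  have c: "x \<in> carrier G" "y \<in> carrier G"
    using assms subgroup.mem_carrier[OF assms(1)] by auto
  show "x \<otimes> inv y \<in> H" using assms by (simp add: subgroup.m_closed subgroup.m_inv_closed)
  show "x \<otimes> inv y \<in> K"
    using rcos_self[OF c(1) subgroup_axioms] assms(4) rcos_module_imp[OF group_axioms c(2)] by simp
qed

lemma coset_absorb:
  assumes "a \<in> K" "x \<in> carrier G"
  shows "K #> (a \<otimes> x) = K #> x"
  using coset_mult_assoc[OF subset, of a x] coset_join2[OF _ subgroup_axioms, of a] assms subset by auto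

lemma card_eq_kernel_times_proj:
  assumes H: "subgroup H G"
  shows "card H = card (H \<inter> K) * card (proj H)"
proof -
  interpret H: subgroup H G by fact
  define r where "r q = (SOME x. x \<in> H \<and> K #> x = q)" for q
  have r: "r q \<in> H" "K #> r q = q" if "q \<in> proj H" for q
    using someI_ex[of "\<lambda>x. x \<in> H \<and> K #> x = q"] that unfolding r_def proj_def by blast+
  have "bij_betw (\<lambda>(a, q). a \<otimes> r q) ((H \<inter> K) \<times> proj H) H"
  proof (rule bij_betw_byWitness[where f' = "\<lambda>x. (x \<otimes> inv (r (K #> x)), K #> x)"])
    have 1: "K #> (a \<otimes> r q) = q" if "a \<in> H" "a \<in> K" "q \<in> proj H" for a q
      using that r by (simp add: coset_absorb H.mem_carrier)
    show "\<forall>p \<in> (H \<inter> K) \<times> proj H.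
        (\<lambda>x. (x \<otimes> inv (r (K #> x)), K #> x)) ((\<lambda>(a, q). a \<otimes> r q) p) = p"
      using r 1 by (auto simp: H.mem_carrier m_assoc)
    have 2: "K #> x \<in> proj H" if "x \<in> H" for x
      using that by (simp add: proj_def)
    show "\<forall>x \<in> H. (\<lambda>(a, q). a \<otimes> r q) ((\<lambda>x. (x \<otimes> inv (r (K #> x)), K #> x)) x) = x"
      using r 2 by (auto simp: H.mem_carrier m_assoc)
    show "(\<lambda>(a, q). a \<otimes> r q) ` ((H \<inter> K) \<times> proj H) \<subseteq> H"
      using r by auto
    show "(\<lambda>x. (x \<otimes> inv (r (K #> x)), K #> x)) ` H \<subseteq> (H \<inter> K) \<times> proj H"
      using r 2 coset_eqD[OF H] by auto
  qed
  then show ?thesis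
    by (metis bij_betw_same_card card_cartesian_product)
qed

section \<open>Intersections inside a coset of the kernel\<close>

text \<open>In a coset of \<open>K\<close>, the three subgroups cut out cosets of \<open>H1 \<inter> K\<close>, \<open>H2 \<inter> K\<close>, \<open>H3 \<inter> K\<close> that meet
  pairwise, in \<open>x\<close>, \<open>y\<close>, \<open>z\<close>. Distributivity splits \<open>x z\<^sup>-\<^sup>1\<close> into factors \<open>b\<close>, \<open>d\<close> that move \<open>x\<close> within
  \<open>H1 \<inter> H2\<close> and \<open>z\<close> within \<open>H2 \<inter> H3\<close> to a common point.\<close>

lemma proj_Helly:
  assumes H: "subgroup H1 G" "subgroup H2 G" "subgroup H3 G"
  shows "proj (H1 \<inter> H2) \<inter> (proj (H1 \<inter> H3) \<inter> proj (H2 \<inter> H3)) \<subseteq> proj (H1 \<inter> H2 \<inter> H3)"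
proof
  fix q assume "q \<in> proj (H1 \<inter> H2) \<inter> (proj (H1 \<inter> H3) \<inter> proj (H2 \<inter> H3))"
  then obtain x y z where x: "x \<in> H1" "x \<in> H2" "q = K #> x" and y: "y \<in> H1" "y \<in> H3" "q = K #> y"
    and z: "z \<in> H2" "z \<in> H3" "q = K #> z"
    unfolding proj_def by auto
  have c: "x \<in> carrier G" "y \<in> carrier G" "z \<in> carrier G"
    using subgroup.mem_carrier[OF H(1)] subgroup.mem_carrier[OF H(2)] x y z by auto
  have xy: "x \<otimes> inv y \<in> H1 \<inter> K" using coset_eqD[OF H(1) x(1) y(1)] x y by simp
  have yz: "y \<otimes> inv z \<in> H3 \<inter> K" using coset_eqD[OF H(3) y(2) z(2)] y z by simp
  have xz: "x \<otimes> inv z \<in> H2 \<inter> K" using coset_eqD[OF H(2) x(2) z(1)] x z by simp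
  have "x \<otimes> inv z = (x \<otimes> inv y) \<otimes> (y \<otimes> inv z)"
    using c by (simp add: mult_inv_mult_inv)
  then have "x \<otimes> inv z \<in> (H1 \<inter> K) <#> (H3 \<inter> K)"
    using xy yz unfolding set_mult_def by blast
  then have "x \<otimes> inv z \<in> (H2 \<inter> K) \<inter> ((H1 \<inter> K) <#> (H3 \<inter> K))"
    using xz by blast
  also have "\<dots> = (H2 \<inter> K \<inter> (H1 \<inter> K)) <#> (H2 \<inter> K \<inter> (H3 \<inter> K))"
    using H by (intro Int_set_mult_kernel subgroups_Inter_pair subgroup_axioms) auto
  finally obtain b d where b: "b \<in> H1" "b \<in> H2" "b \<in> K" and d: "d \<in> H2" "d \<in> H3" "d \<in> K"
    and eq: "x \<otimes> inv z = b \<otimes> d"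
    unfolding set_mult_def by blast
  have c': "b \<in> carrier G" "d \<in> carrier G" using b d mem_carrier by auto
  have "x = b \<otimes> (d \<otimes> z)" using eq c c' by (metis inv_solve_right m_assoc m_closed)
  then have "inv b \<otimes> x = d \<otimes> z" using c c' by (simp add: inv_solve_left')
  moreover have "inv b \<otimes> x \<in> H1 \<inter> H2"
    using b x H by (simp add: subgroup.m_closed subgroup.m_inv_closed)
  moreover have "d \<otimes> z \<in> H3" using d z H by (simp add: subgroup.m_closed)
  ultimately show "q \<in> proj (H1 \<inter> H2 \<inter> H3)"
    using coset_absorb[OF d(3) c(3)] z(3) unfolding proj_def by (metis IntI imageI)
qed

lemma coset_in_proj_set_mult_Int:
  assumes U: "subgroup U G" and V: "subgroup V G" and "u \<in> U" "v \<in> V" "v \<otimes> inv u \<in> N"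
  shows "K #> v \<in> proj ((N <#> U) \<inter> V)"
proof -
  have "v = (v \<otimes> inv u) \<otimes> u"
    using subgroup.mem_carrier[OF U] subgroup.mem_carrier[OF V] assms by (simp add: m_assoc)
  then have "v \<in> N <#> U" using assms unfolding set_mult_def by blast
  then show ?thesis using assms unfolding proj_def by blast
qed

text \<open>How much the image of \<open>U \<inter> V\<close> can grow when \<open>U\<close> is enlarged by \<open>N\<close>: with \<open>W = N U \<inter> V\<close>, both \<open>W\<close>
  and \<open>U\<close> lie in \<open>N U\<close> and intersect in \<open>U \<inter> V\<close>, so the product formula gives
  \<open>|W| |U| \<le> |N U| |U \<inter> V|\<close>. Splitting every order into its part in \<open>K\<close> and its image yields the
  claim, because \<open>N U\<close> and \<open>U\<close> have the same image.\<close>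

lemma card_proj_set_mult_Int_le:
  assumes U: "subgroup U G" and V: "subgroup V G" and N: "subgroup N G" "N \<subseteq> K"
  defines "u \<equiv> card (U \<inter> K)" and "v \<equiv> card (V \<inter> K)"
  shows "card (proj ((N <#> U) \<inter> V)) * lcm u v \<le> card (proj (U \<inter> V)) * lcm (lcm u v) (card N)"
proof -
  define n where "n = card N"
  define W where "W = (N <#> U) \<inter> V"
  note Ni = subgroups_Inter_pair
  have NU: "subgroup (N <#> U) G" using mult_norm_subgroup[OF normal_kernel_subgroup[OF N] U] .
  have W: "subgroup W G" unfolding W_def using NU V by (rule Ni)
  have K: "subgroup K G" by (rule subgroup_axioms)
  have UK: "subgroup (U \<inter> K) G" "U \<inter> K \<subseteq> K" and VK: "subgroup (V \<inter> K) G" "V \<inter> K \<subseteq> K"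
    using Ni[OF U K] Ni[OF V K] by auto
  \<comment> \<open>the modular law\<close>
  have NUK: "(N <#> U) \<inter> K = N <#> (U \<inter> K)"
  proof
    show "N <#> (U \<inter> K) \<subseteq> (N <#> U) \<inter> K" using N(2) by (auto simp: set_mult_def)
    show "(N <#> U) \<inter> K \<subseteq> N <#> (U \<inter> K)"
    proof
      fix x assume "x \<in> (N <#> U) \<inter> K"
      then obtain m y where x: "m \<in> N" "y \<in> U" "x = m \<otimes> y" "x \<in> K" unfolding set_mult_def by blast
      have "m \<in> K" using x N by blast
      then have "y = inv m \<otimes> x"
        using x subgroup.mem_carrier[OF U] mem_carrier by (simp add: m_assoc[symmetric])
      moreover have "inv m \<otimes> x \<in> K" using \<open>m \<in> K\<close> \<open>x \<in> K\<close> by simp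
      ultimately have "y \<in> K" by simp
      with x show "x \<in> N <#> (U \<inter> K)" unfolding set_mult_def by blast
    qed
  qed
  have cardNUK: "card ((N <#> U) \<inter> K) = lcm n u"
    unfolding NUK n_def u_def by (rule card_set_mult_kernel[OF N UK])
  have UNU: "U \<subseteq> N <#> U"
  proof
    fix x assume "x \<in> U"
    moreover have "x = \<one> \<otimes> x" using subgroup.mem_carrier[OF U \<open>x \<in> U\<close>] by simp
    moreover have "\<one> \<in> N" using N(1) by (rule subgroup.one_closed)
    ultimately show "x \<in> N <#> U" unfolding set_mult_def by blast
  qed
  have projNU: "proj (N <#> U) = proj U"
  proof
    show "proj (N <#> U) \<subseteq> proj U"
      using N(2) subgroup.mem_carrier[OF U] by (auto simp: proj_def set_mult_def coset_absorb subset_eq)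
    show "proj U \<subseteq> proj (N <#> U)" using UNU by (rule proj_mono)
  qed
  have WK: "card (W \<inter> K) = gcd (lcm n u) v"
  proof -
    have "W \<inter> K = ((N <#> U) \<inter> K) \<inter> (V \<inter> K)" unfolding W_def by blast
    then show ?thesis
      using card_Int_kernel[OF Ni[OF NU K] _ VK] cardNUK by (simp add: v_def)
  qed
  have UVK: "card (U \<inter> V \<inter> K) = gcd u v"
  proof -
    have "U \<inter> V \<inter> K = (U \<inter> K) \<inter> (V \<inter> K)" by blast
    then show ?thesis using card_Int_kernel[OF UK VK] by (simp add: u_def v_def)
  qed
  have pos: "0 < card A" if "subgroup A G" for A
    using that finite_carrier by (rule subgroup.finite_imp_card_positive)
  have posU: "0 < card (proj U)" and "0 < u" "0 < v" "0 < n"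
    using pos[OF U] pos[OF UK(1)] pos[OF VK(1)] pos[OF N(1)] card_eq_kernel_times_proj[OF U]
    by (auto simp: u_def v_def n_def)
  have "W \<inter> U = U \<inter> V"
    using UNU unfolding W_def by blast
  have "W <#> U \<subseteq> N <#> U"
  proof
    fix x assume "x \<in> W <#> U"
    then obtain w y where "w \<in> W" "y \<in> U" "x = w \<otimes> y" unfolding set_mult_def by blast
    then show "x \<in> N <#> U" using subgroup.m_closed[OF NU, of w y] UNU unfolding W_def by blast
  qed
  then have "card (W <#> U) \<le> card (N <#> U)"
    using finite_carrier subgroup.subset[OF NU] by (meson card_mono finite_subset)
  then have "card W * card U \<le> card (N <#> U) * card (U \<inter> V)"
    using card_mult_le_card_set_mult[OF finite_carrier W U] \<open>W \<inter> U = U \<inter> V\<close>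
    by (metis le_trans mult_le_mono1)
  then have "(gcd (lcm n u) v * card (proj W)) * (u * card (proj U))
      \<le> (lcm n u * card (proj U)) * (gcd u v * card (proj (U \<inter> V)))"
    using card_eq_kernel_times_proj[OF W] card_eq_kernel_times_proj[OF U]
      card_eq_kernel_times_proj[OF NU] card_eq_kernel_times_proj[OF Ni[OF U V]]
    by (simp add: WK UVK cardNUK projNU u_def)
  then have "(gcd (lcm n u) v * card (proj W) * u) * card (proj U)
      \<le> (lcm n u * gcd u v * card (proj (U \<inter> V))) * card (proj U)"
    by (simp only: mult_ac)
  then have "gcd (lcm n u) v * card (proj W) * u \<le> lcm n u * gcd u v * card (proj (U \<inter> V))"
    using posU by simp
  then have "(gcd (lcm n u) v * card (proj W) * u) * v \<le> (lcm n u * gcd u v * card (proj (U \<inter> V))) * v"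
    by (rule mult_le_mono1)
  also have "(gcd (lcm n u) v * card (proj W) * u) * v
      = (gcd (lcm n u) v * gcd u v) * (card (proj W) * lcm u v)"
    using prod_gcd_lcm_nat[of u v] by (simp add: mult_ac)
  also have "(lcm n u * gcd u v * card (proj (U \<inter> V))) * v
      = (gcd (lcm n u) v * gcd u v) * (card (proj (U \<inter> V)) * lcm (lcm n u) v)"
    using prod_gcd_lcm_nat[of "lcm n u" v] by (simp add: mult_ac)
  finally have "card (proj W) * lcm u v \<le> card (proj (U \<inter> V)) * lcm (lcm n u) v"
    using \<open>0 < u\<close> \<open>0 < n\<close> by simp
  then show ?thesis
    by (simp add: W_def n_def lcm.assoc lcm.commute lcm.left_commute)
qed

text \<open>Inside a coset of \<open>K\<close>, a chain from \<open>U\<close> to \<open>V\<close> through \<open>H1\<close> and \<open>H2\<close>, each meeting the next, gives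
  points of \<open>U\<close> and \<open>V\<close> that differ by a product of elements of \<open>H1 \<inter> K\<close> and \<open>H2 \<inter> K\<close>. The chains
  considered are \<open>U, H1, V\<close> and \<open>U, H2, H1, V\<close>.\<close>

lemma proj_subset_proj_set_mult_Int:
  assumes U: "subgroup U G" and V: "subgroup V G" and H1: "subgroup H1 G" and H2: "subgroup H2 G"
  defines "N \<equiv> (H1 \<inter> K) <#> (H2 \<inter> K)"
  shows "proj (H1 \<inter> U) \<inter> proj (H1 \<inter> V) \<subseteq> proj ((N <#> U) \<inter> V)"
    and "proj (H2 \<inter> U) \<inter> (proj (H1 \<inter> H2) \<inter> proj (H1 \<inter> V)) \<subseteq> proj ((N <#> U) \<inter> V)"
proof -
  have one: "\<one> \<in> H2 \<inter> K" using subgroup.one_closed[OF H2] by simp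
  show "proj (H1 \<inter> U) \<inter> proj (H1 \<inter> V) \<subseteq> proj ((N <#> U) \<inter> V)"
  proof
    fix q assume "q \<in> proj (H1 \<inter> U) \<inter> proj (H1 \<inter> V)"
    then obtain x y where x: "x \<in> H1" "x \<in> U" "q = K #> x" and y: "y \<in> H1" "y \<in> V" "q = K #> y"
      unfolding proj_def by auto
    have "y \<otimes> inv x \<in> H1 \<inter> K" using coset_eqD[OF H1 y(1) x(1)] x y by simp
    moreover have "y \<otimes> inv x = (y \<otimes> inv x) \<otimes> \<one>"
      using subgroup.mem_carrier[OF H1 x(1)] subgroup.mem_carrier[OF H1 y(1)] by simp
    ultimately have "y \<otimes> inv x \<in> N" using one unfolding N_def set_mult_def by blast
    then show "q \<in> proj ((N <#> U) \<inter> V)"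
      using coset_in_proj_set_mult_Int[OF U V x(2) y(2)] y(3) by simp
  qed
  show "proj (H2 \<inter> U) \<inter> (proj (H1 \<inter> H2) \<inter> proj (H1 \<inter> V)) \<subseteq> proj ((N <#> U) \<inter> V)"
  proof
    fix q assume "q \<in> proj (H2 \<inter> U) \<inter> (proj (H1 \<inter> H2) \<inter> proj (H1 \<inter> V))"
    then obtain x y z where x: "x \<in> H2" "x \<in> U" "q = K #> x"
      and y: "y \<in> H1" "y \<in> H2" "q = K #> y" and z: "z \<in> H1" "z \<in> V" "q = K #> z"
      unfolding proj_def by auto
    have c: "x \<in> carrier G" "y \<in> carrier G" "z \<in> carrier G"
      using subgroup.mem_carrier[OF H2 x(1)] subgroup.mem_carrier[OF H1 y(1)]
        subgroup.mem_carrier[OF H1 z(1)] by auto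
    have "z \<otimes> inv y \<in> H1 \<inter> K" "y \<otimes> inv x \<in> H2 \<inter> K"
      using coset_eqD[OF H1 z(1) y(1)] coset_eqD[OF H2 y(2) x(1)] x y z by simp_all
    moreover have "z \<otimes> inv x = (z \<otimes> inv y) \<otimes> (y \<otimes> inv x)"
      using c by (simp add: mult_inv_mult_inv)
    ultimately have "z \<otimes> inv x \<in> N" unfolding N_def set_mult_def by blast
    then show "q \<in> proj ((N <#> U) \<inter> V)"
      using coset_in_proj_set_mult_Int[OF U V x(2) z(2)] z(3) by simp
  qed
qed

text \<open>In the second part, \<open>x\<close>, \<open>y\<close>, \<open>z\<close>, \<open>w\<close> are points of a coset of \<open>K\<close> in \<open>H1 \<inter> H3\<close>, \<open>H2 \<inter> H3\<close>, \<open>H1 \<inter> H4\<close>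
  and \<open>H2 \<inter> H4\<close>. The difference \<open>y x\<^sup>-\<^sup>1\<close> lies in \<open>A\<^sub>3\<close>, and in \<open>A\<^sub>2 A\<^sub>1 A\<^sub>4\<close> by the detour over \<open>w\<close> and
  \<open>z\<close>, where \<open>A\<^sub>i\<close> is the intersection of the \<open>i\<close>-th subgroup with \<open>K\<close>. Distributivity places it in
  \<open>A\<^sub>2 A\<^sub>1 M\<close>; the factors from \<open>A\<^sub>2\<close> and \<open>A\<^sub>1\<close> are absorbed by moving \<open>y\<close> in \<open>H2\<close> and \<open>x\<close> in \<open>H1\<close>.\<close>

lemma proj_Int_subset_proj_set_mult_Int:
  assumes H: "subgroup H1 G" "subgroup H2 G" "subgroup H3 G" "subgroup H4 G"
  defines "M \<equiv> H3 \<inter> K \<inter> (H4 \<inter> K)"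
  shows "proj (H1 \<inter> H2) \<subseteq> proj ((M <#> H1) \<inter> H2)"
    and "(proj (H1 \<inter> H3) \<inter> proj (H1 \<inter> H4)) \<inter> (proj (H2 \<inter> H3) \<inter> proj (H2 \<inter> H4))
      \<subseteq> proj ((M <#> H1) \<inter> H2)"
proof -
  show "proj (H1 \<inter> H2) \<subseteq> proj ((M <#> H1) \<inter> H2)"
  proof
    fix q assume "q \<in> proj (H1 \<inter> H2)"
    then obtain x where x: "x \<in> H1" "x \<in> H2" "q = K #> x" unfolding proj_def by auto
    have "x \<otimes> inv x \<in> M"
      using subgroup.mem_carrier[OF H(1) x(1)] H unfolding M_def by (simp add: subgroup.one_closed)
    then show "q \<in> proj ((M <#> H1) \<inter> H2)"
      using coset_in_proj_set_mult_Int[OF H(1,2) x(1,2)] x(3) by simp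
  qed
  show "(proj (H1 \<inter> H3) \<inter> proj (H1 \<inter> H4)) \<inter> (proj (H2 \<inter> H3) \<inter> proj (H2 \<inter> H4))
      \<subseteq> proj ((M <#> H1) \<inter> H2)"
  proof
    fix q
    assume "q \<in> (proj (H1 \<inter> H3) \<inter> proj (H1 \<inter> H4)) \<inter> (proj (H2 \<inter> H3) \<inter> proj (H2 \<inter> H4))"
    then obtain x y z w where x: "x \<in> H1" "x \<in> H3" "q = K #> x"
      and z: "z \<in> H1" "z \<in> H4" "q = K #> z"
      and y: "y \<in> H2" "y \<in> H3" "q = K #> y" and w: "w \<in> H2" "w \<in> H4" "q = K #> w"
      unfolding proj_def by auto
    have c: "x \<in> carrier G" "y \<in> carrier G" "z \<in> carrier G" "w \<in> carrier G"
      using subgroup.mem_carrier[OF H(1) x(1)] subgroup.mem_carrier[OF H(2) y(1)]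
        subgroup.mem_carrier[OF H(1) z(1)] subgroup.mem_carrier[OF H(2) w(1)] by auto
    have yx: "y \<otimes> inv x \<in> H3 \<inter> K" and wz: "w \<otimes> inv z \<in> H4 \<inter> K"
      and yw: "y \<otimes> inv w \<in> H2 \<inter> K" and zx: "z \<otimes> inv x \<in> H1 \<inter> K"
      using coset_eqD[OF H(3) y(2) x(2)] coset_eqD[OF H(4) w(2) z(2)]
        coset_eqD[OF H(2) y(1) w(1)] coset_eqD[OF H(1) z(1) x(1)] x y z w by simp_all
    define B where "B = (H2 \<inter> K) <#> (H1 \<inter> K)"
    have sub: "subgroup (Hi \<inter> K) G" "Hi \<inter> K \<subseteq> K" if "subgroup Hi G" for Hi
      using subgroups_Inter_pair[OF that subgroup_axioms] by auto
    have B: "subgroup B G" "B \<subseteq> K"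
      unfolding B_def using sub H by (simp_all add: subgroup_set_mult_kernel set_mult_kernel_subset)
    have "y \<otimes> inv x = (y \<otimes> inv w) \<otimes> ((w \<otimes> inv z) \<otimes> (z \<otimes> inv x))"
      using c by (simp add: mult_inv_mult_inv)
    also have "(w \<otimes> inv z) \<otimes> (z \<otimes> inv x) = (z \<otimes> inv x) \<otimes> (w \<otimes> inv z)"
      using wz zx by (intro kernel_commute) auto
    also have "(y \<otimes> inv w) \<otimes> ((z \<otimes> inv x) \<otimes> (w \<otimes> inv z))
        = ((y \<otimes> inv w) \<otimes> (z \<otimes> inv x)) \<otimes> (w \<otimes> inv z)"
      using c by (simp add: m_assoc)
    finally have "y \<otimes> inv x \<in> B <#> (H4 \<inter> K)"
      using yw zx wz unfolding B_def set_mult_def by blast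
    then have "y \<otimes> inv x \<in> (H3 \<inter> K) \<inter> (B <#> (H4 \<inter> K))" using yx by blast
    also have "\<dots> = (H3 \<inter> K \<inter> B) <#> (H3 \<inter> K \<inter> (H4 \<inter> K))"
      using B sub H by (intro Int_set_mult_kernel) auto
    finally obtain a m where "a \<in> B" and m: "m \<in> M" and eq: "y \<otimes> inv x = a \<otimes> m"
      unfolding set_mult_def M_def by blast
    then obtain b d where b: "b \<in> H2" "b \<in> K" and d: "d \<in> H1" "d \<in> K" and "a = b \<otimes> d"
      unfolding B_def set_mult_def by blast
    have mK: "m \<in> K" using m by (simp add: M_def)
    have c': "b \<in> carrier G" "d \<in> carrier G" "m \<in> carrier G" using b d mK by simp_all
    have "y = (y \<otimes> inv x) \<otimes> x" using c by (simp add: m_assoc)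
    also have "y \<otimes> inv x = b \<otimes> (m \<otimes> d)"
      using eq \<open>a = b \<otimes> d\<close> kernel_commute[OF mK d(2)] c' by (simp add: m_assoc)
    finally have "inv b \<otimes> y = m \<otimes> (d \<otimes> x)" using c c' by (simp add: m_assoc inv_solve_left')
    then have "(inv b \<otimes> y) \<otimes> inv (d \<otimes> x) = m" using c c' by (simp add: inv_solve_right')
    moreover have "d \<otimes> x \<in> H1" "inv b \<otimes> y \<in> H2"
      using H b d x y by (simp_all add: subgroup.m_closed subgroup.m_inv_closed)
    ultimately have "K #> (inv b \<otimes> y) \<in> proj ((M <#> H1) \<inter> H2)"
      using coset_in_proj_set_mult_Int[OF H(1,2)] m by blast
    then show "q \<in> proj ((M <#> H1) \<inter> H2)"
      using coset_absorb[of "inv b" y] b c y(3) by simp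
  qed
qed

section \<open>The Ingleton inequality\<close>

lemma ingleton_inequality:
  assumes H: "subgroup H1 G" "subgroup H2 G" "subgroup H3 G" "subgroup H4 G"
  shows "card (H1 \<inter> H2) * card (H1 \<inter> H3) * card (H1 \<inter> H4) * card (H2 \<inter> H3) * card (H2 \<inter> H4)
    \<le> card H1 * card H2 * card (H3 \<inter> H4) * card (H1 \<inter> H2 \<inter> H3) * card (H1 \<inter> H2 \<inter> H4)"
proof -
  note Ip = subgroups_Inter_pair
  define a where "a X = card (X \<inter> K)" for X
  define c where "c X = card (proj X)" for X
  have ac: "card X = a X * c X" if "subgroup X G" for X
    unfolding a_def c_def by (rule card_eq_kernel_times_proj[OF that])
  have pos: "0 < a X" "0 < c X" if "subgroup X G" for X
    using ac[OF that] subgroup.finite_imp_card_positive[OF that finite_carrier] by auto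
  have sub: "subgroup (X \<inter> K) G" "X \<inter> K \<subseteq> K" if "subgroup X G" for X
    using Ip[OF that subgroup_axioms] by auto
  have a_Int: "a (X \<inter> Y) = gcd (a X) (a Y)" if "subgroup X G" "subgroup Y G" for X Y
  proof -
    have "X \<inter> Y \<inter> K = (X \<inter> K) \<inter> (Y \<inter> K)" by blast
    then show ?thesis unfolding a_def using card_Int_kernel[OF sub[OF that(1)] sub[OF that(2)]] by simp
  qed
  have c_dvd: "c X dvd c Y" if "proj X \<subseteq> proj Y" "subgroup X G" "subgroup Y G" for X Y
    unfolding c_def
    by (rule quotient.card_subgroup_dvd[OF subgroup_proj[OF that(2)] subgroup_proj[OF that(3)] that(1)])
  have c_mono: "c X dvd c Y" if "X \<subseteq> Y" "subgroup X G" "subgroup Y G" for X Y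
    using c_dvd[OF proj_mono[OF that(1)]] that by blast
  have c_Int: "card (P \<inter> Q) = gcd (card P) (card Q)"
    if "subgroup P (G Mod K)" "subgroup Q (G Mod K)" for P Q
    using quotient.cyclic_card_Int[OF finite_quotient cyclic_quotient that] .
  have c_gcd2: "gcd (c X) (c Y) dvd c Z"
    if "proj X \<inter> proj Y \<subseteq> proj Z" "subgroup X G" "subgroup Y G" "subgroup Z G" for X Y Z
    using quotient.card_subgroup_dvd[OF quotient.subgroups_Inter_pair subgroup_proj that(1)] that(2-4)
    by (simp add: c_def c_Int subgroup_proj)
  have c_gcd3: "gcd (c X) (gcd (c Y) (c W)) dvd c Z"
    if "proj X \<inter> (proj Y \<inter> proj W) \<subseteq> proj Z"
      "subgroup X G" "subgroup Y G" "subgroup W G" "subgroup Z G" for X Y W Z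
    using quotient.card_subgroup_dvd[OF quotient.subgroups_Inter_pair subgroup_proj that(1)] that(2-5)
    by (simp add: c_def c_Int subgroup_proj quotient.subgroups_Inter_pair)
  have c_gcd4: "gcd (gcd (c X) (c Y)) (gcd (c V) (c W)) dvd c Z"
    if "proj X \<inter> proj Y \<inter> (proj V \<inter> proj W) \<subseteq> proj Z"
      "subgroup X G" "subgroup Y G" "subgroup V G" "subgroup W G" "subgroup Z G" for X Y V W Z
    using quotient.card_subgroup_dvd[OF quotient.subgroups_Inter_pair subgroup_proj that(1)] that(2-6)
    by (simp add: c_def c_Int subgroup_proj quotient.subgroups_Inter_pair)
  note I12 = Ip[OF H(1,2)] and I13 = Ip[OF H(1,3)] and I14 = Ip[OF H(1,4)]
    and I23 = Ip[OF H(2,3)] and I24 = Ip[OF H(2,4)] and I34 = Ip[OF H(3,4)]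
  note I123 = Ip[OF I12 H(3)] and I124 = Ip[OF I12 H(4)]
  define N where "N = (H1 \<inter> K) <#> (H2 \<inter> K)"
  define M where "M = H3 \<inter> K \<inter> (H4 \<inter> K)"
  have N: "subgroup N G" "N \<subseteq> K"
    unfolding N_def using sub H by (simp_all add: subgroup_set_mult_kernel set_mult_kernel_subset)
  have N': "N = (H2 \<inter> K) <#> (H1 \<inter> K)"
    unfolding N_def using sub[OF H(1)] sub[OF H(2)] by (rule set_mult_kernel_commute)
  have M: "subgroup M G" "M \<subseteq> K"
    unfolding M_def using sub H by (auto intro: Ip)
  have card_N: "card N = lcm (a H1) (a H2)"
    unfolding N_def a_def using sub[OF H(1)] sub[OF H(2)] by (rule card_set_mult_kernel)
  have card_M: "card M = gcd (a H3) (a H4)"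
    unfolding M_def a_def using sub[OF H(3)] sub[OF H(4)] by (rule card_Int_kernel)
  define E where "E = (N <#> H3) \<inter> H4"
  define E' where "E' = (M <#> H1) \<inter> H2"
  have E: "subgroup E G" and E': "subgroup E' G"
    unfolding E_def E'_def
    using mult_norm_subgroup normal_kernel_subgroup N M H by (simp_all add: Ip)
  note path1 = proj_subset_proj_set_mult_Int[OF H(3,4,1,2), folded N_def, folded E_def]
  \<comment> \<open>\<open>N\<close> is symmetric in \<open>H1\<close> and \<open>H2\<close>, which gives the chains with these two exchanged.\<close>
  note path2 = proj_subset_proj_set_mult_Int[OF H(3,4,2,1), folded N', folded E_def]
  note path3 = proj_Int_subset_proj_set_mult_Int[OF H, folded M_def, folded E'_def]
  have quot: "c (H1 \<inter> H2) * c (H1 \<inter> H2) * c (H1 \<inter> H3) * c (H1 \<inter> H4) * c (H2 \<inter> H3) * c (H2 \<inter> H4)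
      \<le> c H1 * c H2 * c E * c E' * c (H1 \<inter> H2 \<inter> H3) * c (H1 \<inter> H2 \<inter> H4)"
  proof (rule quotient_inequality)
    show "gcd (c (H1 \<inter> H2)) (gcd (c (H1 \<inter> H3)) (c (H2 \<inter> H3))) dvd c (H1 \<inter> H2 \<inter> H3)"
      by (rule c_gcd3[OF proj_Helly[OF H(1,2,3)] I12 I13 I23 I123])
    show "gcd (c (H1 \<inter> H2)) (gcd (c (H1 \<inter> H4)) (c (H2 \<inter> H4))) dvd c (H1 \<inter> H2 \<inter> H4)"
      by (rule c_gcd3[OF proj_Helly[OF H(1,2,4)] I12 I14 I24 I124])
    show "gcd (c (H1 \<inter> H3)) (c (H1 \<inter> H4)) dvd c E"
      by (rule c_gcd2[OF path1(1) I13 I14 E])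
    show "gcd (c (H2 \<inter> H3)) (c (H2 \<inter> H4)) dvd c E"
      by (rule c_gcd2[OF path2(1) I23 I24 E])
    show "gcd (c (H2 \<inter> H3)) (gcd (c (H1 \<inter> H2)) (c (H1 \<inter> H4))) dvd c E"
      by (rule c_gcd3[OF path1(2) I23 I12 I14 E])
    show "gcd (c (H1 \<inter> H3)) (gcd (c (H1 \<inter> H2)) (c (H2 \<inter> H4))) dvd c E"
      by (rule c_gcd3[OF path2(2)[unfolded Int_commute[of H2 H1]] I13 I12 I24 E])
    show "c (H1 \<inter> H2) dvd c E'"
      by (rule c_dvd[OF path3(1) I12 E'])
    show "gcd (gcd (c (H1 \<inter> H3)) (c (H1 \<inter> H4))) (gcd (c (H2 \<inter> H3)) (c (H2 \<inter> H4))) dvd c E'"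
      by (rule c_gcd4[OF path3(2) I13 I14 I23 I24 E'])
  qed (use c_mono pos H I12 I13 I14 I23 I24 I123 I124 E E' in auto)
  have e: "c E * lcm (a H3) (a H4) \<le> c (H3 \<inter> H4) * lcm (lcm (a H3) (a H4)) (lcm (a H1) (a H2))"
    using card_proj_set_mult_Int_le[OF H(3,4) N] by (simp add: E_def c_def a_def[symmetric] card_N)
  have e': "c E' * lcm (a H1) (a H2) \<le> c (H1 \<inter> H2) * lcm (lcm (a H1) (a H2)) (gcd (a H3) (a H4))"
    using card_proj_set_mult_Int_le[OF H(1,2) M] by (simp add: E'_def c_def a_def[symmetric] card_M)
  note kern = kernel_identity[OF pos(1)[OF H(1)] pos(1)[OF H(2)] pos(1)[OF H(3)] pos(1)[OF H(4)]]
  \<comment> \<open>The two estimates are multiplied with the inequality in the quotient and the identity in \<open>K\<close>;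
    the common factors \<open>c12 * l12 * l34\<close> are positive and cancel.\<close>
  define C where "C = c (H1 \<inter> H3) * c (H1 \<inter> H4) * c (H2 \<inter> H3) * c (H2 \<inter> H4)"
  define D where "D = c H1 * c H2 * c (H1 \<inter> H2 \<inter> H3) * c (H1 \<inter> H2 \<inter> H4)"
  define A where "A = a (H1 \<inter> H2) * a (H1 \<inter> H3) * a (H1 \<inter> H4) * a (H2 \<inter> H3) * a (H2 \<inter> H4)"
  define A' where "A' = a H1 * a H2 * a (H3 \<inter> H4) * a (H1 \<inter> H2 \<inter> H3) * a (H1 \<inter> H2 \<inter> H4)"
  define l12 where "l12 = lcm (a H1) (a H2)"
  define l34 where "l34 = lcm (a H3) (a H4)"
  define L where "L = lcm l12 (gcd (a H3) (a H4))"
  define L' where "L' = lcm l34 l12"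
  have kern': "A' * l12 * l34 = A * L * L'"
    using kern H by (simp add: A_def A'_def L_def L'_def l12_def l34_def a_Int Ip gcd.assoc)
  have l: "0 < l12" "0 < l34"
    using pos(1) H by (simp_all add: l12_def l34_def lcm_pos_nat)
  define c12 where "c12 = c (H1 \<inter> H2)"
  have c12: "0 < c12" using pos(2)[OF I12] by (simp add: c12_def)
  have "c12 * l12 * l34 * (A * c12 * C) = A * ((c12 * c12 * C) * (l12 * l34))"
    by (simp add: mult_ac)
  also have "\<dots> \<le> A * ((D * c E * c E') * (l12 * l34))"
    using quot by (intro mult_le_mono2 mult_le_mono1) (simp add: C_def D_def c12_def mult_ac)
  also have "\<dots> = A * D * ((c E * l34) * (c E' * l12))"
    by (simp add: mult_ac)
  also have "\<dots> \<le> A * D * ((c (H3 \<inter> H4) * L') * (c12 * L))"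
    using e e' by (intro mult_le_mono[OF order.refl mult_le_mono])
      (simp_all add: L_def L'_def l12_def l34_def c12_def)
  also have "\<dots> = c12 * D * c (H3 \<inter> H4) * (A * L * L')"
    by (simp add: mult_ac)
  also have "\<dots> = c12 * D * c (H3 \<inter> H4) * (A' * l12 * l34)"
    by (simp only: kern')
  also have "\<dots> = c12 * l12 * l34 * (A' * D * c (H3 \<inter> H4))"
    by (simp add: mult_ac)
  finally have "A * c12 * C \<le> A' * D * c (H3 \<inter> H4)"
    using l c12 by simp
  then show ?thesis
    using H by (simp add: ac Ip A_def A'_def C_def D_def c12_def mult_ac)
qed
end

theorem theorem1p1:
  fixes G :: "('a, 'b) monoid_scheme"
  assumes "group G" and "finite (carrier G)" and "metacyclic_group G"
  shows "\<not> ingleton_violator G"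
proof -
  obtain K where K: "K \<lhd> G" "cyclic_group (G\<lparr>carrier := K\<rparr>)" "cyclic_group (G Mod K)"
    using assms(3) unfolding metacyclic_group_def by blast
  interpret finite_metacyclic K G
    using K assms(2) by (intro finite_metacyclic.intro finite_metacyclic_axioms.intro)
  show ?thesis
    unfolding ingleton_violator_def ingleton_offender_def using ingleton_inequality by blast
qed

end
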